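(* Let $F:V\to\mathbb R$ be convex and $L_F$-smooth ($L_F>0$), let $N:V\to V$ be monotone, and let $x^\star$ be a fixed solution of $\nabla F(x^\star)+N(x^\star)=0$. Let $\epsilon>0$ and let $(x_k,y_k)$ be generated, from $(x_0,y_0)$ with step size $\alpha=\sqrt{\epsilon/L_F}$, by the perturbed EPC-VOS scheme $$\frac{\tilde x_{k+1}-x_k}{\alpha}=y_k-\tilde x_{k+1},\qquad \frac{y_{k+1}-y_k}{\alpha}=\tilde x_{k+1}-y_{k+1}-\frac1\epsilon\big(\nabla F(\tilde x_{k+1})+N(y_{k+1})\big),\qquad \frac{x_{k+1}-x_k}{\alpha}=y_{k+1}-x_{k+1}.$$ Assume there exists $R>0$ such that $\|x_k-x^\star\|\le R$ for all $k\ge0$. Then, with $\mathcal E(x,y,\epsilon)=D_F(x,x^\star)+\frac\epsilon2\|y-x^\star\|^2$, $$\mathcal E(x_k,y_k,\epsilon)\le\left(\frac1{1+\sqrt{\epsilon/L_F}}\right)^{k}\mathcal E(x_0,y_0,\epsilon)+\epsilon R^2,\qquad k\ge0.$$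
   Context: $V$ is a real Hilbert space with inner product $(\cdot,\cdot)$ and norm $\|\cdot\|$, identified with its dual. $N$ is monotone if $(N(x)-N(y),x-y)\ge0$ for all $x,y$. $F$ is $L_F$-smooth if it is continuously differentiable with $L_F$-Lipschitz gradient. The Bregman divergence is $D_F(y,x)=F(y)-F(x)-\langle\nabla F(x),y-x\rangle$. *)

theory Defs
  imports "HOL-Analysis.Analysis"
begin

text \<open>
  A real Hilbert space is a type of sort \<open>{real_inner, complete_space}\<close>. In line with the
  identification of the space with its dual, the gradient is the vector representing the
  Frechet derivative through the inner product, i.e. \<open>GDERIV\<close>.
\<close>

definition grad :: "('a::real_inner \<Rightarrow> real) \<Rightarrow> 'a \<Rightarrow> 'a" where
  "grad F x = (THE D. GDERIV F x :> D)"

lemma grad_eqI: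
  assumes "GDERIV F x :> D"
  shows "grad F x = D"
  unfolding grad_def
proof (rule the_equality)
  show "GDERIV F x :> D" by (fact assms)
next
  fix E assume "GDERIV F x :> E"
  then have "(\<lambda>h. inner h E) = (\<lambda>h. inner h D)"
    using assms unfolding gderiv_def by (rule has_derivative_unique)
  then have "inner (E - D) E = inner (E - D) D" by metis
  then have "inner (E - D) (E - D) = 0" by (simp add: inner_diff_right)
  then show "E = D" by simp
qed

definition continuously_differentiable :: "('a::real_inner \<Rightarrow> real) \<Rightarrow> bool" where
  "continuously_differentiable F \<longleftrightarrow>
     (\<forall>x. \<exists>D. GDERIV F x :> D) \<and> continuous_on UNIV (grad F)"

definition smooth_with :: "real \<Rightarrow> ('a::real_inner \<Rightarrow> real) \<Rightarrow> bool" where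
  "smooth_with L F \<longleftrightarrow> continuously_differentiable F \<and> L-lipschitz_on UNIV (grad F)"

definition monotone_operator :: "('a::real_inner \<Rightarrow> 'a) \<Rightarrow> bool" where
  "monotone_operator N \<longleftrightarrow> (\<forall>x y. inner (N x - N y) (x - y) \<ge> 0)"

definition bregman :: "('a::real_inner \<Rightarrow> real) \<Rightarrow> 'a \<Rightarrow> 'a \<Rightarrow> real" where
  "bregman F y x = F y - F x - inner (grad F x) (y - x)"

definition lyapunov :: "('a::real_inner \<Rightarrow> real) \<Rightarrow> 'a \<Rightarrow> 'a \<Rightarrow> 'a \<Rightarrow> real \<Rightarrow> real" where
  "lyapunov F xstar x y \<epsilon> = bregman F x xstar + \<epsilon> / 2 * (norm (y - xstar))\<^sup>2"

text \<open>
  The scheme is implicit in \<open>y (Suc k)\<close>, hence a relation on sequences. The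
  auxiliary point of step \<open>k\<close> is \<open>xt (Suc k)\<close>; \<open>xt 0\<close> is irrelevant.
\<close>

definition perturbed_epc_vos ::
  "('a::real_inner \<Rightarrow> real) \<Rightarrow> ('a \<Rightarrow> 'a) \<Rightarrow> real \<Rightarrow> real \<Rightarrow>
   (nat \<Rightarrow> 'a) \<Rightarrow> (nat \<Rightarrow> 'a) \<Rightarrow> (nat \<Rightarrow> 'a) \<Rightarrow> bool" where
  "perturbed_epc_vos F N \<epsilon> \<alpha> x xt y \<longleftrightarrow>
     (\<forall>k. (xt (Suc k) - x k) /\<^sub>R \<alpha> = y k - xt (Suc k) \<and>
          (y (Suc k) - y k) /\<^sub>R \<alpha> =
            xt (Suc k) - y (Suc k) - (1 / \<epsilon>) *\<^sub>R (grad F (xt (Suc k)) + N (y (Suc k))) \<and>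
          (x (Suc k) - x k) /\<^sub>R \<alpha> = y (Suc k) - x (Suc k))"

end

theory Submission
  imports Defs
begin

text \<open>
  Write \<open>E\<^sub>k\<close> for the Lyapunov function after \<open>k\<close> steps, \<open>a = sqrt (\<epsilon> / L)\<close>, and measure all points
  relative to \<open>x\<^sup>\<star>\<close>. Let \<open>q = x\<^sub>k\<close>, \<open>u = y\<^sub>k\<close>, \<open>v = y\<^sub>k\<^sub>+\<^sub>1\<close>, \<open>z = x\<^sub>k\<^sub>+\<^sub>1\<close>, and let \<open>w\<close> be the
  auxiliary point of the step. Convexity and the descent lemma control the Bregman part,
  monotonicity of \<open>N\<close> together with the implicit update controls the quadratic part, and the
  gradient terms cancel exactly because \<open>z\<close> is the average of \<open>q\<close> and \<open>v\<close> with weights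
  \<open>1\<close> and \<open>a\<close>. What remains (\<open>lyapunov_step\<close>) is
  \<open>(1 + a) E\<^sub>k\<^sub>+\<^sub>1 \<le> E\<^sub>k + (a \<epsilon> / 2) C\<^sub>k\<close> with
  \<open>C\<^sub>k = \<bar>w\<bar>\<^sup>2 - \<bar>w - v\<bar>\<^sup>2 - \<bar>v - u\<bar>\<^sup>2 / (1 + a)\<close>.

  If \<open>C\<^sub>k \<le> 2 R\<^sup>2\<close> held in every step, then \<open>E\<^sub>k - \<epsilon> R\<^sup>2\<close> would contract by the factor \<open>1 / (1 + a)\<close>,
  which is the claim. Only the points \<open>x\<^sub>k\<close> are known to lie in the ball of radius \<open>R\<close>. For
  \<open>k \<ge> 1\<close> this is enough: the scheme expresses \<open>u\<close>, \<open>v\<close> and \<open>w\<close> linearly by \<open>x\<^sub>k\<^sub>-\<^sub>1\<close>, \<open>x\<^sub>k\<close> and \<open>x\<^sub>k\<^sub>+\<^sub>1\<close>,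
  and a weighted sum of the squared norms of these three points, with weights adding up to \<open>2\<close>,
  dominates \<open>C\<^sub>k\<close> (\<open>excess_le_radius\<close>).

  In the first step \<open>u = y\<^sub>0\<close> is arbitrary and \<open>C\<^sub>0\<close> need not be bounded by \<open>2 R\<^sup>2\<close>. But if \<open>y\<^sub>0\<close> is
  far away then \<open>E\<^sub>0\<close> is large, whereas \<open>E\<^sub>1\<close> is bounded directly, because \<open>x\<^sub>0\<close> and \<open>x\<^sub>1\<close>
  determine \<open>y\<^sub>1\<close>. A convex combination of this crude bound on \<open>E\<^sub>1\<close> and of the step inequality gives
  \<open>(1 + a) E\<^sub>1 \<le> E\<^sub>0 + (1 + a) \<epsilon> R\<^sup>2\<close> (by \<open>excess_first_step\<close>). This is weaker than
  a contraction of \<open>E\<^sub>0 - \<epsilon> R\<^sup>2\<close>, but it is all that the claim for \<open>k = 1\<close> asks for, and later steps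
  contract from there.
\<close>

section \<open>Convex functions with Lipschitz gradient\<close>

lemma GDERIV_grad:
  assumes "smooth_with L F"
  shows "GDERIV F x :> grad F x"
  using assms grad_eqI unfolding smooth_with_def continuously_differentiable_def by metis

lemma DERIV_along_line:
  assumes "smooth_with L F"
  shows "((\<lambda>t. F (x + t *\<^sub>R v)) has_real_derivative inner (grad F (x + t *\<^sub>R v)) v) (at t)"
proof -
  have "((\<lambda>t. x + t *\<^sub>R v) has_derivative (\<lambda>h. h *\<^sub>R v)) (at t)"
    by (auto intro!: derivative_eq_intros)
  moreover have "(F has_derivative (\<lambda>h. inner h (grad F (x + t *\<^sub>R v)))) (at (x + t *\<^sub>R v))"
    using GDERIV_grad[OF assms] unfolding gderiv_def .
  ultimately have "((\<lambda>t. F (x + t *\<^sub>R v)) has_derivative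
      (\<lambda>h. inner (h *\<^sub>R v) (grad F (x + t *\<^sub>R v)))) (at t)"
    by (rule has_derivative_compose)
  then show ?thesis
    unfolding has_field_derivative_def
    by (rule has_derivative_eq_rhs) (auto simp: inner_commute mult.commute)
qed

text \<open>
  The descent lemma: along the segment from \<open>x\<close> to \<open>z\<close>, the difference of the divergence and the
  quadratic is nonincreasing, since the Lipschitz bound makes its derivative nonpositive.
\<close>

lemma bregman_le_quadratic:
  assumes "smooth_with L F"
  shows "bregman F z x \<le> L / 2 * (norm (z - x))\<^sup>2"
proof -
  define v where "v = z - x"
  define \<phi> where "\<phi> t = F (x + t *\<^sub>R v) - t * inner (grad F x) v - L * t\<^sup>2 / 2 * (norm v)\<^sup>2" for t :: real
  have "\<phi> 1 \<le> \<phi> 0"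
  proof (rule DERIV_nonpos_imp_nonincreasing[of 0 1 \<phi>])
    fix t :: real assume t: "0 \<le> t" "t \<le> 1"
    let ?d = "inner (grad F (x + t *\<^sub>R v)) v - inner (grad F x) v - L * t * (norm v)\<^sup>2"
    have "(\<phi> has_real_derivative ?d) (at t)"
      unfolding \<phi>_def
      by (rule derivative_eq_intros DERIV_along_line[OF assms] refl | simp)+
    moreover have "?d \<le> 0"
    proof -
      have "norm (grad F (x + t *\<^sub>R v) - grad F x) \<le> L * (t * norm v)"
        using assms t lipschitz_onD[of L UNIV "grad F" "x + t *\<^sub>R v" x]
        unfolding smooth_with_def by (simp add: dist_norm)
      then have "norm (grad F (x + t *\<^sub>R v) - grad F x) * norm v \<le> L * (t * norm v) * norm v"
        by (rule mult_right_mono) simp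
      with norm_cauchy_schwarz[of "grad F (x + t *\<^sub>R v) - grad F x" v]
      show ?thesis by (simp add: inner_diff_left power2_eq_square mult.assoc)
    qed
    ultimately show "\<exists>y. DERIV \<phi> t :> y \<and> y \<le> 0" by blast
  qed simp
  then show ?thesis by (simp add: \<phi>_def bregman_def v_def)
qed

text \<open>A convex function lies above its tangents; it suffices to look at the line through the two points.\<close>

lemma bregman_nonneg:
  assumes "convex_on UNIV F" "smooth_with L F"
  shows "bregman F z x \<ge> 0"
proof -
  define f where "f t = F (x + t *\<^sub>R (z - x))" for t :: real
  have "convex_on UNIV f"
  proof (rule convex_onI)
    fix t a b :: real assume t: "0 < t" "t < 1"
    have "x + ((1 - t) *\<^sub>R a + t *\<^sub>R b) *\<^sub>R (z - x)
        = (1 - t) *\<^sub>R (x + a *\<^sub>R (z - x)) + t *\<^sub>R (x + b *\<^sub>R (z - x))"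
      by (simp add: algebra_simps)
    then show "f ((1 - t) *\<^sub>R a + t *\<^sub>R b) \<le> (1 - t) * f a + t * f b"
      unfolding f_def using convex_onD[OF assms(1), of t] t by simp
  qed simp
  moreover have "(f has_real_derivative inner (grad F x) (z - x)) (at 0)"
    using DERIV_along_line[OF assms(2), of x "z - x" 0] by (simp add: f_def[abs_def])
  ultimately have "f 1 - f 0 \<ge> inner (grad F x) (z - x) * (1 - 0)"
    by (intro convex_on_imp_above_tangent[of UNIV]) auto
  then show ?thesis by (simp add: f_def bregman_def)
qed

lemma bregman_three_point:
  "bregman F z xs = bregman F w xs + bregman F z w + inner (grad F w - grad F xs) (z - w)"
  by (simp add: bregman_def algebra_simps)

section \<open>Energy balance of one step\<close>

text \<open>
  The amount by which one step can fail to contract the Lyapunov function, up to the factor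
  \<open>a * \<epsilon> / 2\<close>. The arguments are relative to the solution: \<open>w\<close> is the auxiliary point, and \<open>u\<close> and \<open>v\<close>
  are the old and the new \<open>y\<close>.
\<close>

definition excess :: "real \<Rightarrow> 'a::real_inner \<Rightarrow> 'a \<Rightarrow> 'a \<Rightarrow> real" where
  "excess a w u v = (norm w)\<^sup>2 - (norm (w - v))\<^sup>2 - (norm (v - u))\<^sup>2 / (1 + a)"

text \<open>
  The descent lemma passes from \<open>w\<close> to \<open>z\<close> in the Bregman part. Its quadratic error is
  absorbed by the term \<open>- \<epsilon> / 2 * (norm (v - u))\<^sup>2\<close> that the implicit update of \<open>y\<close> provides: since
  \<open>z - w\<close> is a multiple of \<open>v - u\<close> and \<open>L * a\<^sup>2 = \<epsilon>\<close>, it is only the fraction \<open>1 / (1 + a)\<close> of that term.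
\<close>

lemma lyapunov_step:
  fixes F :: "'a::real_inner \<Rightarrow> real"
  assumes F: "convex_on UNIV F" "smooth_with L F" and N: "monotone_operator N"
    and xs: "grad F xs + N xs = 0"
    and pos: "L > 0" "\<epsilon> > 0" and a: "a = sqrt (\<epsilon> / L)"
    and w: "(1 + a) *\<^sub>R w = x + a *\<^sub>R u"
    and v: "v - u = a *\<^sub>R (w - v) - (a / \<epsilon>) *\<^sub>R (grad F w + N v)"
    and z: "(1 + a) *\<^sub>R z = x + a *\<^sub>R v"
  shows "(1 + a) * lyapunov F xs z v \<epsilon>
    \<le> lyapunov F xs x u \<epsilon> + a * \<epsilon> / 2 * excess a (w - xs) (u - xs) (v - xs)"
proof -
  have a0: "a > 0" and La: "L * a\<^sup>2 = \<epsilon>" using pos a by auto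
  define g where "g = grad F w - grad F xs"
  define m where "m = N v - N xs"
  have gm: "grad F w + N v = g + m"
    using xs by (simp add: g_def m_def algebra_simps)
  have mono: "inner m (v - xs) \<ge> 0"
    using N by (simp add: monotone_operator_def m_def)
  let ?D = "\<lambda>y. bregman F y xs"
  have Dx: "?D x \<ge> ?D w + inner g (x - w)"
    using bregman_three_point[of F x xs w] bregman_nonneg[OF F, of x w] by (simp add: g_def)
  have Dw: "?D w \<le> inner g (w - xs)"
  proof -
    have "?D xs = 0" by (simp add: bregman_def)
    then show ?thesis
      using bregman_three_point[of F xs xs w] bregman_nonneg[OF F, of xs w]
      by (simp add: g_def inner_diff_right)
  qed
  have zw: "(1 + a) *\<^sub>R (z - w) = a *\<^sub>R (v - u)"
    using w z by (simp add: algebra_simps)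
  have nzw: "(1 + a)\<^sup>2 * (norm (z - w))\<^sup>2 = a\<^sup>2 * (norm (v - u))\<^sup>2"
  proof -
    have "norm ((1 + a) *\<^sub>R (z - w)) = norm (a *\<^sub>R (v - u))" using zw by simp
    then have "(1 + a) * norm (z - w) = a * norm (v - u)" using a0 by simp
    then show ?thesis by (metis power_mult_distrib)
  qed
  have quad: "(1 + a) * (L / 2 * (norm (z - w))\<^sup>2) = \<epsilon> / 2 * (norm (v - u))\<^sup>2 / (1 + a)"
  proof -
    have "(1 + a) * ((1 + a) * (L / 2 * (norm (z - w))\<^sup>2))
        = L / 2 * ((1 + a)\<^sup>2 * (norm (z - w))\<^sup>2)"
      by (simp add: power2_eq_square)
    also have "\<dots> = (L * a\<^sup>2) / 2 * (norm (v - u))\<^sup>2" unfolding nzw by simp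
    finally show ?thesis unfolding La using a0 by (simp add: field_simps)
  qed
  have Dz: "(1 + a) * ?D z \<le> (1 + a) * ?D w + inner g ((1 + a) *\<^sub>R (z - w))
      + \<epsilon> / 2 * (norm (v - u))\<^sup>2 / (1 + a)"
  proof -
    have "?D z \<le> ?D w + inner g (z - w) + L / 2 * (norm (z - w))\<^sup>2"
      using bregman_three_point[of F z xs w] bregman_le_quadratic[OF F(2), of z w]
      by (simp add: g_def)
    then have "(1 + a) * ?D z \<le> (1 + a) * (?D w + inner g (z - w) + L / 2 * (norm (z - w))\<^sup>2)"
      using a0 by (intro mult_left_mono) auto
    then show ?thesis unfolding quad[symmetric] by (simp add: distrib_left)
  qed
  have potential: "(1 + a) * ?D z - ?D x \<le> a * inner g (v - xs)
      + \<epsilon> / 2 * (norm (v - u))\<^sup>2 / (1 + a)"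
  proof -
    have "a * ?D w \<le> a * inner g (w - xs)"
      using Dw a0 by (intro mult_left_mono) auto
    then have "(1 + a) * ?D z - ?D x
      \<le> a * inner g (w - xs) - inner g (x - w) + inner g ((1 + a) *\<^sub>R (z - w))
        + \<epsilon> / 2 * (norm (v - u))\<^sup>2 / (1 + a)"
      using Dz Dx by (simp add: distrib_right)
    also have "a * inner g (w - xs) - inner g (x - w) + inner g ((1 + a) *\<^sub>R (z - w))
        = inner g (a *\<^sub>R (w - xs) - (x - w) + (1 + a) *\<^sub>R (z - w))"
      by (simp add: inner_simps)
    \<comment> \<open>The point \<open>w\<close> cancels, so the gradient at \<open>w\<close> meets the direction \<open>v - xs\<close> alone, as in
      the inner product of the \<open>y\<close> update with \<open>v - xs\<close>.\<close>
    also have "a *\<^sub>R (w - xs) - (x - w) + (1 + a) *\<^sub>R (z - w) = a *\<^sub>R (v - xs)"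
      using z by (simp add: algebra_simps)
    finally show ?thesis by simp
  qed
  have kinetic: "\<epsilon> * inner (v - u) (v - xs)
      \<le> a * \<epsilon> * inner (w - v) (v - xs) - a * inner g (v - xs)"
  proof -
    have "\<epsilon> * inner (v - u) (v - xs) = a * \<epsilon> * inner (w - v) (v - xs) - a * inner (g + m) (v - xs)"
      unfolding v gm using pos by (simp add: inner_diff_left right_diff_distrib)
    then show ?thesis using mono a0 by (simp add: inner_add_left distrib_left)
  qed
  have pol1: "(norm (v - xs))\<^sup>2 - (norm (u - xs))\<^sup>2
      = 2 * inner (v - u) (v - xs) - (norm (v - u))\<^sup>2"
    by (simp add: power2_norm_eq_inner inner_simps inner_commute)
  have pol2: "2 * inner (w - v) (v - xs) + (norm (v - xs))\<^sup>2 = (norm (w - xs))\<^sup>2 - (norm (w - v))\<^sup>2"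
    by (simp add: power2_norm_eq_inner inner_simps inner_commute)
  have "(1 + a) * (\<epsilon> / 2 * (norm (v - xs))\<^sup>2) - \<epsilon> / 2 * (norm (u - xs))\<^sup>2
      = \<epsilon> / 2 * ((norm (v - xs))\<^sup>2 - (norm (u - xs))\<^sup>2) + a * \<epsilon> / 2 * (norm (v - xs))\<^sup>2"
    by (simp add: algebra_simps)
  also have "\<dots> = \<epsilon> * inner (v - u) (v - xs) - \<epsilon> / 2 * (norm (v - u))\<^sup>2 + a * \<epsilon> / 2 * (norm (v - xs))\<^sup>2"
    unfolding pol1 by (simp add: algebra_simps)
  also have "\<dots> \<le> a * \<epsilon> / 2 * (2 * inner (w - v) (v - xs) + (norm (v - xs))\<^sup>2)
      - a * inner g (v - xs) - \<epsilon> / 2 * (norm (v - u))\<^sup>2"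
    using kinetic by (simp add: algebra_simps)
  finally have *: "(1 + a) * (\<epsilon> / 2 * (norm (v - xs))\<^sup>2) - \<epsilon> / 2 * (norm (u - xs))\<^sup>2
      \<le> a * \<epsilon> / 2 * ((norm (w - xs))\<^sup>2 - (norm (w - v))\<^sup>2)
      - a * inner g (v - xs) - \<epsilon> / 2 * (norm (v - u))\<^sup>2"
    unfolding pol2 .
  have split: "a * \<epsilon> / 2 * excess a (w - xs) (u - xs) (v - xs)
      = a * \<epsilon> / 2 * ((norm (w - xs))\<^sup>2 - (norm (w - v))\<^sup>2)
        + \<epsilon> / 2 * (norm (v - u))\<^sup>2 / (1 + a) - \<epsilon> / 2 * (norm (v - u))\<^sup>2"
  proof -
    have "a * \<epsilon> / 2 * (n / (1 + a)) = \<epsilon> / 2 * n - \<epsilon> / 2 * n / (1 + a)" for n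
      using a0 by (simp add: field_simps)
    then show ?thesis by (simp add: excess_def right_diff_distrib)
  qed
  show ?thesis
    unfolding split using potential * by (simp add: lyapunov_def distrib_left)
qed

section \<open>Bounds on the excess\<close>

lemma norm_lincomb_squared:
  fixes x y :: "'a::real_inner"
  shows "(norm (c *\<^sub>R x + d *\<^sub>R y))\<^sup>2
    = c\<^sup>2 * (norm x)\<^sup>2 + 2 * c * d * inner x y + d\<^sup>2 * (norm y)\<^sup>2"
  using dot_norm[of "c *\<^sub>R x" "d *\<^sub>R y"]
  by (simp add: power_mult_distrib field_simps)

text \<open>
  Completing squares, first in \<open>u\<close> and then in \<open>q\<close>: the second hypothesis is a leading minor of
  the coefficient matrix, and the third says that its determinant, up to the factor \<open>\<kappa>\<close>, is nonnegative.
\<close>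

lemma quadratic_form3_nonneg:
  fixes q v u :: "'a::real_inner"
  assumes k: "\<kappa> > 0" and p: "\<kappa> * \<alpha> - \<mu>\<^sup>2 > 0"
    and d: "(\<kappa> * \<alpha> - \<mu>\<^sup>2) * (\<kappa> * \<gamma> - \<nu>\<^sup>2) \<ge> (\<kappa> * \<beta> - \<mu> * \<nu>)\<^sup>2"
  shows "\<kappa> * (norm u)\<^sup>2 + 2 * \<mu> * inner q u + 2 * \<nu> * inner v u
    + \<alpha> * (norm q)\<^sup>2 + 2 * \<beta> * inner q v + \<gamma> * (norm v)\<^sup>2 \<ge> 0" (is "?Q \<ge> 0")
proof -
  define A B C where "A = \<kappa> * \<alpha> - \<mu>\<^sup>2" and "B = \<kappa> * \<beta> - \<mu> * \<nu>" and "C = \<kappa> * \<gamma> - \<nu>\<^sup>2"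
  have "A * (A * (norm q)\<^sup>2 + 2 * B * inner q v + C * (norm v)\<^sup>2)
      = (norm (A *\<^sub>R q + B *\<^sub>R v))\<^sup>2 + (A * C - B\<^sup>2) * (norm v)\<^sup>2"
    unfolding norm_lincomb_squared by algebra
  also have "\<dots> \<ge> 0" using d by (simp add: A_def B_def C_def)
  finally have "A * (norm q)\<^sup>2 + 2 * B * inner q v + C * (norm v)\<^sup>2 \<ge> 0"
    using p by (simp add: A_def zero_le_mult_iff)
  moreover have "\<kappa> * ?Q = (norm (\<kappa> *\<^sub>R u + (\<mu> *\<^sub>R q + \<nu> *\<^sub>R v)))\<^sup>2
      + (A * (norm q)\<^sup>2 + 2 * B * inner q v + C * (norm v)\<^sup>2)"
  proof -
    have "inner u (\<mu> *\<^sub>R q + \<nu> *\<^sub>R v) = \<mu> * inner q u + \<nu> * inner v u"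
      by (simp add: inner_add_right inner_commute)
    then have "(norm (\<kappa> *\<^sub>R u + (\<mu> *\<^sub>R q + \<nu> *\<^sub>R v)))\<^sup>2
        = \<kappa>\<^sup>2 * (norm u)\<^sup>2 + 2 * \<kappa> * (\<mu> * inner q u + \<nu> * inner v u)
          + (\<mu>\<^sup>2 * (norm q)\<^sup>2 + 2 * \<mu> * \<nu> * inner q v + \<nu>\<^sup>2 * (norm v)\<^sup>2)"
      using norm_lincomb_squared[of \<kappa> u 1 "\<mu> *\<^sub>R q + \<nu> *\<^sub>R v"]
        norm_lincomb_squared[of \<mu> q \<nu> v] by simp
    then show ?thesis unfolding A_def B_def C_def by algebra
  qed
  ultimately have "\<kappa> * ?Q \<ge> 0" by simp
  then show ?thesis using k by (simp add: zero_le_mult_iff)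
qed

lemma excess_scaled:
  fixes a :: real
  assumes a: "a > 0" and w: "(1 + a) *\<^sub>R w = q + a *\<^sub>R u"
  shows "(1 + a) * excess a w u v
    = 2 * inner (q + a *\<^sub>R u) v - (1 + a) * (norm v)\<^sup>2 - (norm (v - u))\<^sup>2"
proof -
  have "excess a w u v = 2 * inner w v - (norm v)\<^sup>2 - (norm (v - u))\<^sup>2 / (1 + a)"
    by (simp add: excess_def power2_norm_eq_inner inner_simps inner_commute)
  then have "(1 + a) * excess a w u v = 2 * inner ((1 + a) *\<^sub>R w) v - (1 + a) * (norm v)\<^sup>2
      - (1 + a) * ((norm (v - u))\<^sup>2 / (1 + a))"
    by (simp add: right_diff_distrib)
  then show ?thesis unfolding w using a by simp
qed

text \<open>
  From the second step on, the previous iterate \<open>p\<close> bounds \<open>u\<close>. The excess is at most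
  \<open>\<lambda>\<^sub>p \<bar>p\<bar>\<^sup>2 + \<lambda>\<^sub>q \<bar>q\<bar>\<^sup>2 + \<lambda>\<^sub>z \<bar>z\<bar>\<^sup>2\<close> with the weights \<open>1 / (2 (1 + a))\<close>, \<open>a / (2 (1 + a))\<close> and \<open>3 / 2\<close>, whose
  sum is \<open>2\<close>. The constant \<open>2\<close> cannot be improved uniformly in \<open>a\<close>: for \<open>a = 2\<close> it is attained
  at \<open>q = z = - p\<close> with norm \<open>R\<close>. At this step size the multipliers are forced, and the
  weights above interpolate them; the determinant of the resulting form has the factor \<open>(a - 2)\<^sup>2\<close>.
\<close>

lemma excess_le_radius:
  fixes p q z u v w :: "'a::real_inner"
  assumes a: "a > 0"
    and q: "(1 + a) *\<^sub>R q = p + a *\<^sub>R u"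
    and w: "(1 + a) *\<^sub>R w = q + a *\<^sub>R u"
    and z: "(1 + a) *\<^sub>R z = q + a *\<^sub>R v"
    and R: "norm p \<le> R" "norm q \<le> R" "norm z \<le> R"
  shows "excess a w u v \<le> 2 * R\<^sup>2"
proof -
  define s where "s = 1 + a"
  have s: "s > 0" using a by (simp add: s_def)
  \<comment> \<open>The form below is \<open>2 * s\<^sup>2\<close> times the weighted sum minus the excess, written in \<open>q\<close>, \<open>u\<close>
    and \<open>v\<close>, which avoids denominators: \<open>p = s q - a u\<close> and \<open>s z = q + a v\<close>.\<close>
  define \<kappa> \<mu> \<nu> \<alpha> \<beta> \<gamma> where
    "\<kappa> = s * (a\<^sup>2 + 2)" and "\<mu> = - a * s\<^sup>2" and "\<nu> = - 2 * s\<^sup>2"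
    and "\<alpha> = s * (s\<^sup>2 + a) + 3" and "\<beta> = a - 2" and "\<gamma> = 5 * a\<^sup>2 + 6 * a + 4"
  have A: "\<kappa> * \<alpha> - \<mu>\<^sup>2 = s * (a ^ 4 + 3 * a ^ 3 + 11 * a\<^sup>2 + 8 * a + 8)"
    unfolding \<kappa>_def \<mu>_def \<alpha>_def s_def by algebra
  have disc: "(\<kappa> * \<alpha> - \<mu>\<^sup>2) * (\<kappa> * \<gamma> - \<nu>\<^sup>2) - (\<kappa> * \<beta> - \<mu> * \<nu>)\<^sup>2
      = s\<^sup>2 * (a - 2)\<^sup>2 * (a ^ 6 + a ^ 5 + 6 * a ^ 4 + 8 * a ^ 3 + 10 * a\<^sup>2 + 12 * a + 4)"
    unfolding \<kappa>_def \<mu>_def \<alpha>_def \<nu>_def \<beta>_def \<gamma>_def s_def by algebra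
  have expand: "(norm (s *\<^sub>R q - a *\<^sub>R u))\<^sup>2
      = s\<^sup>2 * (norm q)\<^sup>2 - 2 * s * a * inner q u + a\<^sup>2 * (norm u)\<^sup>2"
    "(norm (q + a *\<^sub>R v))\<^sup>2 = (norm q)\<^sup>2 + 2 * a * inner q v + a\<^sup>2 * (norm v)\<^sup>2"
    "(norm (v - u))\<^sup>2 = (norm v)\<^sup>2 - 2 * inner v u + (norm u)\<^sup>2"
    "inner (q + a *\<^sub>R u) v = inner q v + a * inner v u"
    using norm_lincomb_squared[of s q "- a" u] norm_lincomb_squared[of 1 q a v]
      norm_lincomb_squared[of 1 v "- 1" u]
    by (simp_all add: inner_add_left inner_commute[of u v])
  have "\<kappa> * (norm u)\<^sup>2 + 2 * \<mu> * inner q u + 2 * \<nu> * inner v u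
      + \<alpha> * (norm q)\<^sup>2 + 2 * \<beta> * inner q v + \<gamma> * (norm v)\<^sup>2 \<ge> 0"
  proof (rule quadratic_form3_nonneg)
    show "\<kappa> > 0" using a s by (simp add: \<kappa>_def add_nonneg_pos)
    show "\<kappa> * \<alpha> - \<mu>\<^sup>2 > 0" unfolding A using a s by (simp add: add_pos_pos)
    have "(\<kappa> * \<alpha> - \<mu>\<^sup>2) * (\<kappa> * \<gamma> - \<nu>\<^sup>2) - (\<kappa> * \<beta> - \<mu> * \<nu>)\<^sup>2 \<ge> 0"
      unfolding disc using a by simp
    then show "(\<kappa> * \<alpha> - \<mu>\<^sup>2) * (\<kappa> * \<gamma> - \<nu>\<^sup>2) \<ge> (\<kappa> * \<beta> - \<mu> * \<nu>)\<^sup>2" by simp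
  qed
  also have "\<kappa> * (norm u)\<^sup>2 + 2 * \<mu> * inner q u + 2 * \<nu> * inner v u
      + \<alpha> * (norm q)\<^sup>2 + 2 * \<beta> * inner q v + \<gamma> * (norm v)\<^sup>2
    = s * ((norm (s *\<^sub>R q - a *\<^sub>R u))\<^sup>2 + a * (norm q)\<^sup>2) + 3 * (norm (q + a *\<^sub>R v))\<^sup>2
      - 2 * s * (2 * inner (q + a *\<^sub>R u) v - s * (norm v)\<^sup>2 - (norm (v - u))\<^sup>2)"
    unfolding \<kappa>_def \<mu>_def \<alpha>_def \<nu>_def \<beta>_def \<gamma>_def expand
    unfolding s_def by algebra
  also have "2 * inner (q + a *\<^sub>R u) v - s * (norm v)\<^sup>2 - (norm (v - u))\<^sup>2 = s * excess a w u v"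
    using excess_scaled[OF a w] by (simp add: s_def)
  also have "s *\<^sub>R q - a *\<^sub>R u = p" using q by (simp add: s_def)
  also have "q + a *\<^sub>R v = s *\<^sub>R z" using z by (simp add: s_def)
  finally have "2 * s\<^sup>2 * excess a w u v
      \<le> s * ((norm p)\<^sup>2 + a * (norm q)\<^sup>2) + 3 * s\<^sup>2 * (norm z)\<^sup>2"
    by (simp add: power_mult_distrib power2_eq_square algebra_simps)
  also have "\<dots> \<le> s * (R\<^sup>2 + a * R\<^sup>2) + 3 * s\<^sup>2 * R\<^sup>2"
    using a s R by (intro add_mono mult_left_mono power_mono) auto
  also have "\<dots> = 2 * s\<^sup>2 * (2 * R\<^sup>2)"
    by (simp add: s_def power2_eq_square algebra_simps)
  finally show ?thesis using s by simp
qed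

text \<open>
  Without a previous iterate, the excess can be larger than \<open>2 R\<^sup>2\<close>. Here the step inequality has
  the weight \<open>(1 + 2 a) / (1 + a)\<^sup>2\<close> and the direct bound on the new energy the weight \<open>a\<^sup>2 / (1 + a)\<^sup>2\<close>;
  the term with \<open>u\<close> comes from the part of the old energy that the combination leaves over. For small \<open>a\<close>
  the direct bound is useless and for large \<open>a\<close> it suffices by itself, hence the form of
  the weights. The final bound uses the mean of \<open>\<bar>q\<bar>\<^sup>2\<close> and \<open>\<bar>z\<bar>\<^sup>2\<close> with weights \<open>1\<close> and \<open>a\<close>.
\<close>

lemma excess_first_step:
  fixes q z u v w :: "'a::real_inner"
  assumes a: "a > 0"
    and w: "(1 + a) *\<^sub>R w = q + a *\<^sub>R u"
    and z: "(1 + a) *\<^sub>R z = q + a *\<^sub>R v"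
    and R: "norm q \<le> R" "norm z \<le> R"
  shows "(1 + 2 * a) * a * excess a w u v
      + (1 + a) * ((norm z)\<^sup>2 + a\<^sup>2 * (norm v)\<^sup>2) - a\<^sup>2 * (norm u)\<^sup>2
    \<le> 2 * (1 + a) ^ 3 * R\<^sup>2"
proof -
  define s where "s = 1 + a"
  have s: "s > 0" using a by (simp add: s_def)
  \<comment> \<open>The form below is \<open>s\<^sup>2\<close> times the difference of the two sides, with
    \<open>2 * s\<^sup>2 * ((norm q)\<^sup>2 + a * (norm z)\<^sup>2)\<close> on the right.\<close>
  define \<kappa> \<mu> \<nu> \<alpha> \<beta> \<gamma> where
    "\<kappa> = a * s * (a\<^sup>2 + 3 * a + 1)" and "\<mu> = (0::real)" and "\<nu> = - (1 + 2 * a) * a * s\<^sup>2"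
    and "\<alpha> = 2 * s\<^sup>2 * (s\<^sup>2 + a) - s"
    and "\<beta> = 2 * s\<^sup>2 * a\<^sup>2 - (1 + 2 * a) * a * s - a * s"
    and "\<gamma> = 2 * s\<^sup>2 * a ^ 3 + (1 + 2 * a) * a * s\<^sup>2 + (1 + 2 * a) * a * s - a\<^sup>2 * s - a\<^sup>2 * s ^ 3"
  have A: "\<kappa> * \<alpha> - \<mu>\<^sup>2 = \<kappa> * (2 * a ^ 4 + 10 * a ^ 3 + 16 * a\<^sup>2 + 9 * a + 1)"
  proof -
    have "\<alpha> = 2 * a ^ 4 + 10 * a ^ 3 + 16 * a\<^sup>2 + 9 * a + 1"
      unfolding \<alpha>_def s_def by algebra
    then show ?thesis by (simp add: \<mu>_def)
  qed
  have disc: "(\<kappa> * \<alpha> - \<mu>\<^sup>2) * (\<kappa> * \<gamma> - \<nu>\<^sup>2) - (\<kappa> * \<beta> - \<mu> * \<nu>)\<^sup>2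
      = \<kappa> * (a * s) * (a + 9 * a\<^sup>2 + 35 * a ^ 3 + 75 * a ^ 4 + 91 * a ^ 5 + 55 * a ^ 6
        + 9 * a ^ 7 + 3 * a ^ 8 + 14 * a ^ 9 + 10 * a ^ 10 + 2 * a ^ 11)"
    unfolding \<kappa>_def \<mu>_def \<alpha>_def \<nu>_def \<beta>_def \<gamma>_def s_def
      mult_zero_left zero_power2 diff_zero by algebra
  have k: "\<kappa> > 0" using a s by (simp add: \<kappa>_def add_pos_pos)
  have expand: "(norm (q + a *\<^sub>R v))\<^sup>2 = (norm q)\<^sup>2 + 2 * a * inner q v + a\<^sup>2 * (norm v)\<^sup>2"
    "(norm (v - u))\<^sup>2 = (norm v)\<^sup>2 - 2 * inner v u + (norm u)\<^sup>2"
    "inner (q + a *\<^sub>R u) v = inner q v + a * inner v u"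
    using norm_lincomb_squared[of 1 q a v]
      norm_lincomb_squared[of 1 v "- 1" u]
    by (simp_all add: inner_add_left inner_commute[of u v])
  have "\<kappa> * (norm u)\<^sup>2 + 2 * \<mu> * inner q u + 2 * \<nu> * inner v u
      + \<alpha> * (norm q)\<^sup>2 + 2 * \<beta> * inner q v + \<gamma> * (norm v)\<^sup>2 \<ge> 0"
  proof (rule quadratic_form3_nonneg)
    show "\<kappa> > 0" by (fact k)
    show "\<kappa> * \<alpha> - \<mu>\<^sup>2 > 0" unfolding A using a k by (simp add: add_pos_pos)
    have "(\<kappa> * \<alpha> - \<mu>\<^sup>2) * (\<kappa> * \<gamma> - \<nu>\<^sup>2) - (\<kappa> * \<beta> - \<mu> * \<nu>)\<^sup>2 \<ge> 0"
      unfolding disc using a s k by simp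
    then show "(\<kappa> * \<alpha> - \<mu>\<^sup>2) * (\<kappa> * \<gamma> - \<nu>\<^sup>2) \<ge> (\<kappa> * \<beta> - \<mu> * \<nu>)\<^sup>2" by simp
  qed
  also have "\<kappa> * (norm u)\<^sup>2 + 2 * \<mu> * inner q u + 2 * \<nu> * inner v u
      + \<alpha> * (norm q)\<^sup>2 + 2 * \<beta> * inner q v + \<gamma> * (norm v)\<^sup>2
    = 2 * s\<^sup>2 * (s\<^sup>2 * (norm q)\<^sup>2 + a * (norm (q + a *\<^sub>R v))\<^sup>2)
      - (1 + 2 * a) * a * s * (2 * inner (q + a *\<^sub>R u) v - s * (norm v)\<^sup>2 - (norm (v - u))\<^sup>2)
      - s * (norm (q + a *\<^sub>R v))\<^sup>2 - a\<^sup>2 * s ^ 3 * (norm v)\<^sup>2 + a\<^sup>2 * s\<^sup>2 * (norm u)\<^sup>2"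
    unfolding \<kappa>_def \<mu>_def \<alpha>_def \<nu>_def \<beta>_def \<gamma>_def expand
    unfolding s_def by algebra
  also have "2 * inner (q + a *\<^sub>R u) v - s * (norm v)\<^sup>2 - (norm (v - u))\<^sup>2 = s * excess a w u v"
    using excess_scaled[OF a w] by (simp add: s_def)
  also have "q + a *\<^sub>R v = s *\<^sub>R z" using z by (simp add: s_def)
  finally have "s\<^sup>2 * ((1 + 2 * a) * a * excess a w u v
      + s * ((norm z)\<^sup>2 + a\<^sup>2 * (norm v)\<^sup>2) - a\<^sup>2 * (norm u)\<^sup>2)
      \<le> s\<^sup>2 * (2 * s\<^sup>2 * ((norm q)\<^sup>2 + a * (norm z)\<^sup>2))"
    by (simp add: power_mult_distrib power2_eq_square power3_eq_cube algebra_simps)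
  then have "(1 + 2 * a) * a * excess a w u v
      + s * ((norm z)\<^sup>2 + a\<^sup>2 * (norm v)\<^sup>2) - a\<^sup>2 * (norm u)\<^sup>2
      \<le> 2 * s\<^sup>2 * ((norm q)\<^sup>2 + a * (norm z)\<^sup>2)"
    by (rule mult_left_le_imp_le) (use s in simp)
  also have "\<dots> \<le> 2 * s\<^sup>2 * (R\<^sup>2 + a * R\<^sup>2)"
    using a s R by (intro add_mono mult_left_mono power_mono) auto
  also have "\<dots> = 2 * s ^ 3 * R\<^sup>2"
    by (simp add: s_def power2_eq_square power3_eq_cube algebra_simps)
  finally show ?thesis by (simp add: s_def)
qed

section \<open>Convergence up to the perturbation\<close>

text \<open>
  The scheme with the division by the step size cleared: both \<open>x\<close> updates are weighted averages.
\<close>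

lemma perturbed_epc_vos_step:
  assumes "perturbed_epc_vos F N \<epsilon> a x xt y" "a > 0"
  shows "(1 + a) *\<^sub>R xt (Suc k) = x k + a *\<^sub>R y k"
    and "y (Suc k) - y k = a *\<^sub>R (xt (Suc k) - y (Suc k))
      - (a / \<epsilon>) *\<^sub>R (grad F (xt (Suc k)) + N (y (Suc k)))"
    and "(1 + a) *\<^sub>R x (Suc k) = x k + a *\<^sub>R y (Suc k)"
proof -
  have clear: "d = a *\<^sub>R e" if "d /\<^sub>R a = e" for d e :: 'a
    using that assms(2) by (auto simp flip: that)
  have eqs: "(xt (Suc k) - x k) /\<^sub>R a = y k - xt (Suc k)"
    "(y (Suc k) - y k) /\<^sub>R a =
      xt (Suc k) - y (Suc k) - (1 / \<epsilon>) *\<^sub>R (grad F (xt (Suc k)) + N (y (Suc k)))"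
    "(x (Suc k) - x k) /\<^sub>R a = y (Suc k) - x (Suc k)"
    using assms(1) unfolding perturbed_epc_vos_def by blast+
  show "(1 + a) *\<^sub>R xt (Suc k) = x k + a *\<^sub>R y k"
    using clear[OF eqs(1)] by (simp add: algebra_simps)
  show "y (Suc k) - y k = a *\<^sub>R (xt (Suc k) - y (Suc k))
      - (a / \<epsilon>) *\<^sub>R (grad F (xt (Suc k)) + N (y (Suc k)))"
    using clear[OF eqs(2)] by (simp add: scaleR_diff_right)
  show "(1 + a) *\<^sub>R x (Suc k) = x k + a *\<^sub>R y (Suc k)"
    using clear[OF eqs(3)] by (simp add: algebra_simps)
qed

theorem theorem8p3:
  fixes F :: "'a::{real_inner, complete_space} \<Rightarrow> real"
    and N :: "'a \<Rightarrow> 'a"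
    and xstar :: 'a
    and x xt y :: "nat \<Rightarrow> 'a"
    and L \<epsilon> \<alpha> R :: real
    and k :: nat
  assumes "L > 0"
    and "convex_on UNIV F"
    and "smooth_with L F"
    and "monotone_operator N"
    and "grad F xstar + N xstar = 0"
    and "\<epsilon> > 0"
    and "\<alpha> = sqrt (\<epsilon> / L)"
    and "perturbed_epc_vos F N \<epsilon> \<alpha> x xt y"
    and "R > 0"
    and "\<And>j. norm (x j - xstar) \<le> R"
  shows "lyapunov F xstar (x k) (y k) \<epsilon>
           \<le> (1 / (1 + sqrt (\<epsilon> / L))) ^ k * lyapunov F xstar (x 0) (y 0) \<epsilon> + \<epsilon> * R\<^sup>2"
proof -
  define E where "E j = lyapunov F xstar (x j) (y j) \<epsilon>" for j
  define C where "C j = excess \<alpha> (xt (Suc j) - xstar) (y j - xstar) (y (Suc j) - xstar)" for j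
  have a: "\<alpha> > 0" and La: "L * \<alpha>\<^sup>2 = \<epsilon>" using assms(1,6,7) by auto
  note step = perturbed_epc_vos_step[OF assms(8) a]
  have balance: "(1 + \<alpha>) * E (Suc j) \<le> E j + \<alpha> * \<epsilon> / 2 * C j" for j
    unfolding E_def C_def
    by (rule lyapunov_step[OF assms(2-5,1,6,7) step])
  have shift: "(1 + \<alpha>) *\<^sub>R (b - xstar) = (c - xstar) + \<alpha> *\<^sub>R (d - xstar)"
    if "(1 + \<alpha>) *\<^sub>R b = c + \<alpha> *\<^sub>R d" for b c d
    using that by (simp add: algebra_simps)

  have first: "(1 + \<alpha>) * E 1 \<le> E 0 + (1 + \<alpha>) * (\<epsilon> * R\<^sup>2)"
  proof -
    let ?z = "(norm (x 1 - xstar))\<^sup>2" and ?v = "(norm (y 1 - xstar))\<^sup>2"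
      and ?u = "(norm (y 0 - xstar))\<^sup>2"
    have gap: "(1 + 2 * \<alpha>) * \<alpha> * C 0 + (1 + \<alpha>) * (?z + \<alpha>\<^sup>2 * ?v) - \<alpha>\<^sup>2 * ?u
        \<le> 2 * (1 + \<alpha>) ^ 3 * R\<^sup>2"
      using excess_first_step[OF a shift[OF step(1)] shift[OF step(3)] assms(10,10), of 0]
      by (simp add: C_def)
    \<comment> \<open>The direct bound ignores the old energy; the factor \<open>\<alpha>\<^sup>2\<close> turns \<open>L\<close> into \<open>\<epsilon>\<close>.\<close>
    have direct: "\<alpha>\<^sup>2 * E 1 \<le> \<epsilon> / 2 * (?z + \<alpha>\<^sup>2 * ?v)"
    proof -
      have "E 1 \<le> L / 2 * ?z + \<epsilon> / 2 * ?v"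
        using bregman_le_quadratic[OF assms(3), of "x 1" xstar] by (simp add: E_def lyapunov_def)
      then have "\<alpha>\<^sup>2 * E 1 \<le> \<alpha>\<^sup>2 * (L / 2 * ?z + \<epsilon> / 2 * ?v)" by (rule mult_left_mono) simp
      also have "\<dots> = (L * \<alpha>\<^sup>2) / 2 * ?z + \<epsilon> / 2 * (\<alpha>\<^sup>2 * ?v)" by (simp add: algebra_simps)
      finally show ?thesis unfolding La by (simp add: distrib_left)
    qed
    have E0: "\<epsilon> / 2 * ?u \<le> E 0"
      using bregman_nonneg[OF assms(2,3), of "x 0" xstar] by (simp add: E_def lyapunov_def)
    have "(1 + \<alpha>)\<^sup>2 * ((1 + \<alpha>) * E 1)
        = (1 + 2 * \<alpha>) * ((1 + \<alpha>) * E 1) + (1 + \<alpha>) * (\<alpha>\<^sup>2 * E 1)"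
      by (simp add: power2_eq_square algebra_simps)
    also have "\<dots> \<le> (1 + 2 * \<alpha>) * (E 0 + \<alpha> * \<epsilon> / 2 * C 0)
        + (1 + \<alpha>) * (\<epsilon> / 2 * (?z + \<alpha>\<^sup>2 * ?v))"
      using balance[of 0] direct a by (intro add_mono mult_left_mono) auto
    also have "\<dots> = (1 + 2 * \<alpha>) * E 0 + \<alpha>\<^sup>2 * (\<epsilon> / 2 * ?u)
        + \<epsilon> / 2 * ((1 + 2 * \<alpha>) * \<alpha> * C 0 + (1 + \<alpha>) * (?z + \<alpha>\<^sup>2 * ?v) - \<alpha>\<^sup>2 * ?u)"
      by (simp add: algebra_simps add_divide_distrib)
    also have "\<dots> \<le> (1 + 2 * \<alpha>) * E 0 + \<alpha>\<^sup>2 * E 0 + \<epsilon> / 2 * (2 * (1 + \<alpha>) ^ 3 * R\<^sup>2)"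
      using E0 gap assms(6) by (intro add_mono mult_left_mono order_refl) auto
    also have "\<dots> = (1 + \<alpha>)\<^sup>2 * (E 0 + (1 + \<alpha>) * (\<epsilon> * R\<^sup>2))"
      by (simp add: power2_eq_square power3_eq_cube algebra_simps)
    finally show ?thesis
      by (rule mult_left_le_imp_le) (use a in simp)
  qed

  \<comment> \<open>Step \<open>j + 1\<close> has the previous iterate \<open>x j\<close>, so its excess is bounded.\<close>
  have later: "(1 + \<alpha>) * (E (Suc (Suc j)) - \<epsilon> * R\<^sup>2) \<le> E (Suc j) - \<epsilon> * R\<^sup>2" for j
  proof -
    have "C (Suc j) \<le> 2 * R\<^sup>2"
      unfolding C_def
      by (rule excess_le_radius[OF a shift[OF step(3)] shift[OF step(1)] shift[OF step(3)]
            assms(10,10,10)])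
    then have "\<alpha> * \<epsilon> / 2 * C (Suc j) \<le> \<alpha> * \<epsilon> / 2 * (2 * R\<^sup>2)"
      using a assms(6) by (intro mult_left_mono) auto
    with balance[of "Suc j"] show ?thesis by (simp add: algebra_simps)
  qed

  have decay: "(1 + \<alpha>) ^ Suc j * (E (Suc j) - \<epsilon> * R\<^sup>2) \<le> E 0" for j
  proof (induction j)
    case 0
    then show ?case using first by (simp add: algebra_simps)
  next
    case (Suc j)
    have "(1 + \<alpha>) ^ Suc (Suc j) * (E (Suc (Suc j)) - \<epsilon> * R\<^sup>2)
        = (1 + \<alpha>) ^ Suc j * ((1 + \<alpha>) * (E (Suc (Suc j)) - \<epsilon> * R\<^sup>2))"
      by simp
    also have "\<dots> \<le> (1 + \<alpha>) ^ Suc j * (E (Suc j) - \<epsilon> * R\<^sup>2)"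
      using later[of j] a by (intro mult_left_mono) auto
    finally show ?case using Suc by simp
  qed
  have "E k \<le> (1 / (1 + \<alpha>)) ^ k * E 0 + \<epsilon> * R\<^sup>2"
  proof (cases k)
    case 0
    then show ?thesis using assms(6) by simp
  next
    case (Suc j)
    have "E k - \<epsilon> * R\<^sup>2 \<le> E 0 / (1 + \<alpha>) ^ k"
      using decay[of j] a unfolding Suc[symmetric] by (simp add: pos_le_divide_eq mult.commute)
    then show ?thesis by (simp add: power_one_over)
  qed
  then show ?thesis by (simp add: E_def assms(7))
qed

end
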